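(* Let $(A,\Delta,r)$ be a cosymplectic left Alia coalgebra over $K$, with $r=\sum_i a_i\otimes b_i\in A\otimes A$, and let $\omega\in(A\otimes A)^*$. Suppose that $(A,[,]_\omega,\Delta)$ is a dual triangular left Alia bialgebra, where $[x,y]_\omega=x_{(2)}\omega(x_{(1)},y)-x_{(1)}\omega(x_{(2)},y)-y_{(2)}\omega(x,y_{(1)})$ with $\Delta(x)=x_{(1)}\otimes x_{(2)}$, and further that $(A,[,]_\omega,\Delta_r)$ is a triangular left Alia bialgebra, where $\Delta_r(x)=\sum_i\big(([a_i,x]_\omega-[x,a_i]_\omega)\otimes b_i-a_i\otimes[b_i,x]_\omega\big)$. Then $((A,\Delta),S)$ is a Nijenhuis left Alia coalgebra, where $S:A\to A$ is given by $S(x):=\sum_i a_i\,\omega(b_i,x)$ for $x\in A$.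
   Context: All vector spaces are over a field $K$ of characteristic zero; Sweedler notation is used without summation sign. A left Alia algebra is $(A,[,])$ with $[,]$ bilinear and $[[x,y],z]+[[y,z],x]+[[z,x],y]=[[y,x],z]+[[z,y],x]+[[x,z],y]$. A left Alia coalgebra is $(A,\Delta)$ with $\Delta:A\to A\otimes A$ linear and $$x_{(1)(2)}\otimes x_{(1)(1)}\otimes x_{(2)}+x_{(1)(1)}\otimes x_{(2)}\otimes x_{(1)(2)}+x_{(2)}\otimes x_{(1)(2)}\otimes x_{(1)(1)}=x_{(1)(1)}\otimes x_{(1)(2)}\otimes x_{(2)}+x_{(1)(2)}\otimes x_{(2)}\otimes x_{(1)(1)}+x_{(2)}\otimes x_{(1)(1)}\otimes x_{(1)(2)},$$ where $x_{(1)(1)}\otimes x_{(1)(2)}\otimes x_{(2)}=(\Delta\otimes\mathrm{id})\Delta(x)$. It is a Nijenhuis left Alia coalgebra with a linear map $S$ if $S(x_{(1)})\otimes S(x_{(2)})+S^2(x)_{(1)}\otimes S^2(x)_{(2)}=S(S(x)_{(1)})\otimes S(x)_{(2)}+S(x)_{(1)}\otimes S(S(x)_{(2)})$ for all $x$. A cosymplectic left Alia coalgebra $(A,\Delta,r)$ is a left Alia coalgebra with an antisymmetric element $r=\sum_i a_i\otimes b_i$ (i.e. $r+\tau(r)=0$, $\tau$ the flip) such that $$\sum_i\big(a_{i(1)}\otimes a_{i(2)}\otimes b_i-a_{i(2)}\otimes a_{i(1)}\otimes b_i-a_{i(2)}\otimes b_i\otimes a_{i(1)}+b_i\otimes a_{i(2)}\otimes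 a_{i(1)}\big)=0.$$ A left Alia bialgebra is $(A,[,],\Delta)$ with $(A,[,])$ a left Alia algebra, $(A,\Delta)$ a left Alia coalgebra and $(\tau-\mathrm{id}^{\otimes 2})(\Delta([x,y]-[y,x]))=(\tau-\mathrm{id}^{\otimes 2})((\mathcal R(y)\otimes\mathrm{id})\Delta(x)-(\mathcal R(x)\otimes\mathrm{id})\Delta(y))$, where $\mathcal R(y)z=[z,y]$. The left Alia Yang-Baxter equation in a left Alia algebra $(A,[,])$ for $r=\sum_i a_i\otimes b_i$ is $$\sum_{i,j}\big([a_i,a_j]\otimes b_i\otimes b_j+a_i\otimes([a_j,b_i]-[b_i,a_j])\otimes b_j-a_i\otimes a_j\otimes[b_j,b_i]\big)=0.$$ A left Alia bialgebra $(A,[,],\Delta_r)$ (with $\Delta_r(x)=\sum_i(([a_i,x]-[x,a_i])\otimes b_i-a_i\otimes[b_i,x])$) is triangular when $r$ is an antisymmetric solution of this equation in $(A,[,])$. The co-left Alia Yang-Baxter equation in $(A,\Delta)$ for a bilinear form $\omega$ is $$\omega(x_{(1)},y)\omega(x_{(2)},z)+\omega(x,y_{(2)})\omega(y_{(1)},z)=\omega(x,y_{(1)})\omega(y_{(2)},z)+\omega(x,z_{(2)})\omega(y,z_{(1)})\quad\text{for all }x,y,z\in A.$$ The left Alia bialgebra $(A,[,]_\omega,\Delta)$ is dual triangular when $\omega$ is a skew-symmetric solution of the co-left Alia Yang-Baxter equation in $(A,\Delta)$. *)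

theory Defs
  imports Complex_Main "HOL-Library.Function_Algebras"
begin

section \<open>Tensor powers of a vector space\<close>

text \<open>
  The space \<open>A\<close> is the whole type \<open>'a\<close>, with scalar multiplication \<open>s\<close> by a field \<open>'k\<close>.
  The tensor \<open>x \<otimes> y\<close> is the functional evaluating a bilinear form at \<open>(x, y)\<close>, and \<open>A \<otimes> A\<close> is the
  span of these functionals in the dual of the space of bilinear forms; likewise for three factors
  and trilinear forms. This is a model of the tensor product in every dimension, since multilinear
  forms separate the elements of an algebraic tensor product of vector spaces. Arguments that are not
  multilinear are sent to \<open>0\<close>, so that equality of functionals is equality of tensors.
\<close>

definition bilinear_map ::
    "('k::field \<Rightarrow> 'a::ab_group_add \<Rightarrow> 'a) \<Rightarrow> ('k \<Rightarrow> 'v::ab_group_add \<Rightarrow> 'v) \<Rightarrow> ('a \<Rightarrow> 'a \<Rightarrow> 'v) \<Rightarrow> bool" where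
  "bilinear_map s sV f \<longleftrightarrow>
     (\<forall>x. Vector_Spaces.linear s sV (\<lambda>y. f x y)) \<and> (\<forall>y. Vector_Spaces.linear s sV (\<lambda>x. f x y))"

definition trilinear_map ::
    "('k::field \<Rightarrow> 'a::ab_group_add \<Rightarrow> 'a) \<Rightarrow> ('k \<Rightarrow> 'v::ab_group_add \<Rightarrow> 'v) \<Rightarrow> ('a \<Rightarrow> 'a \<Rightarrow> 'a \<Rightarrow> 'v) \<Rightarrow> bool" where
  "trilinear_map s sV f \<longleftrightarrow>
     (\<forall>x y. Vector_Spaces.linear s sV (\<lambda>z. f x y z)) \<and>
     (\<forall>x z. Vector_Spaces.linear s sV (\<lambda>y. f x y z)) \<and>
     (\<forall>y z. Vector_Spaces.linear s sV (\<lambda>x. f x y z))"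

type_synonym ('a, 'k) tensor2 = "('a \<Rightarrow> 'a \<Rightarrow> 'k) \<Rightarrow> 'k"
type_synonym ('a, 'k) tensor3 = "('a \<Rightarrow> 'a \<Rightarrow> 'a \<Rightarrow> 'k) \<Rightarrow> 'k"

definition fscale :: "'k::field \<Rightarrow> ('b \<Rightarrow> 'k) \<Rightarrow> 'b \<Rightarrow> 'k" where
  "fscale c F = (\<lambda>b. c * F b)"

definition tens2 :: "('k::field \<Rightarrow> 'a::ab_group_add \<Rightarrow> 'a) \<Rightarrow> 'a \<Rightarrow> 'a \<Rightarrow> ('a, 'k) tensor2" where
  "tens2 s x y = (\<lambda>B. if bilinear_map s (*) B then B x y else 0)"

definition tens3 :: "('k::field \<Rightarrow> 'a::ab_group_add \<Rightarrow> 'a) \<Rightarrow> 'a \<Rightarrow> 'a \<Rightarrow> 'a \<Rightarrow> ('a, 'k) tensor3" where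
  "tens3 s x y z = (\<lambda>T. if trilinear_map s (*) T then T x y z else 0)"

definition tensor2_space :: "('k::field \<Rightarrow> 'a::ab_group_add \<Rightarrow> 'a) \<Rightarrow> ('a, 'k) tensor2 set" where
  "tensor2_space s = module.span fscale {tens2 s x y | x y. True}"

text \<open>
  For bilinear \<open>f\<close>, \<open>tensor_lift s f t\<close> is the value at \<open>t\<close> of the linear map on \<open>A \<otimes> A\<close> induced by \<open>f\<close>:
  it is \<open>\<Sum>\<^sub>i f u\<^sub>i v\<^sub>i\<close> for any representation \<open>t = \<Sum>\<^sub>i u\<^sub>i \<otimes> v\<^sub>i\<close>. With \<open>t = \<Delta> x\<close> this is what Sweedler
  notation denotes by \<open>f x\<^sub>(\<^sub>1\<^sub>) x\<^sub>(\<^sub>2\<^sub>)\<close>. That the value does not depend on the representation is shown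
  in \<open>tensor_lift_sum\<close> below.
\<close>

definition tensor_lift ::
    "('k::field \<Rightarrow> 'a::ab_group_add \<Rightarrow> 'a) \<Rightarrow> ('a \<Rightarrow> 'a \<Rightarrow> 'v::comm_monoid_add) \<Rightarrow> ('a, 'k) tensor2 \<Rightarrow> 'v" where
  "tensor_lift s f t =
     (THE w. \<forall>us. t = (\<Sum>(u, v)\<leftarrow>us. tens2 s u v) \<longrightarrow> w = (\<Sum>(u, v)\<leftarrow>us. f u v))"

definition tensor_flip :: "('k::field \<Rightarrow> 'a::ab_group_add \<Rightarrow> 'a) \<Rightarrow> ('a, 'k) tensor2 \<Rightarrow> ('a, 'k) tensor2" where
  "tensor_flip s = tensor_lift s (\<lambda>u v. tens2 s v u)"

definition tensor_map ::
    "('k::field \<Rightarrow> 'a::ab_group_add \<Rightarrow> 'a) \<Rightarrow> ('a \<Rightarrow> 'a) \<Rightarrow> ('a \<Rightarrow> 'a) \<Rightarrow> ('a, 'k) tensor2 \<Rightarrow> ('a, 'k) tensor2" where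
  "tensor_map s f g = tensor_lift s (\<lambda>u v. tens2 s (f u) (g v))"

text \<open>
  Only the values on \<open>A \<otimes> A\<close> of an element of \<open>(A \<otimes> A)*\<close> matter; \<open>form_of\<close> is the corresponding
  bilinear form.
\<close>

definition tensor2_dual :: "('k::field \<Rightarrow> 'a::ab_group_add \<Rightarrow> 'a) \<Rightarrow> (('a, 'k) tensor2 \<Rightarrow> 'k) set" where
  "tensor2_dual s = {\<phi>.
     (\<forall>t\<in>tensor2_space s. \<forall>t'\<in>tensor2_space s. \<phi> (t + t') = \<phi> t + \<phi> t') \<and>
     (\<forall>c. \<forall>t\<in>tensor2_space s. \<phi> (fscale c t) = c * \<phi> t)}"

definition form_of ::
    "('k::field \<Rightarrow> 'a::ab_group_add \<Rightarrow> 'a) \<Rightarrow> (('a, 'k) tensor2 \<Rightarrow> 'k) \<Rightarrow> 'a \<Rightarrow> 'a \<Rightarrow> 'k" where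
  "form_of s \<phi> x y = \<phi> (tens2 s x y)"


subsection \<open>Universal property\<close>

lemma vector_space_fscale: "vector_space (fscale :: 'k::field \<Rightarrow> ('b \<Rightarrow> 'k) \<Rightarrow> 'b \<Rightarrow> 'k)"
  by unfold_locales (auto simp: fscale_def fun_eq_iff algebra_simps)

lemma vector_space_times: "vector_space ((*) :: 'k::field \<Rightarrow> 'k \<Rightarrow> 'k)"
  by unfold_locales (auto simp: algebra_simps)

lemma linear_sum_list:
  assumes "Vector_Spaces.linear s sV f"
  shows "f (\<Sum>(u, v)\<leftarrow>us. g u v) = (\<Sum>(u, v)\<leftarrow>us. f (g u v))"
proof -
  interpret Vector_Spaces.linear s sV f by fact
  show ?thesis by (induction us) (auto simp: zero add)
qed

lemma bilinear_map_iff: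
  "bilinear_map s sV f \<longleftrightarrow> vector_space s \<and> vector_space sV \<and>
     (\<forall>x y z. f (x + y) z = f x z + f y z) \<and> (\<forall>c x z. f (s c x) z = sV c (f x z)) \<and>
     (\<forall>x y z. f x (y + z) = f x y + f x z) \<and> (\<forall>c x y. f x (s c y) = sV c (f x y))"
  unfolding bilinear_map_def Vector_Spaces.linear_iff by (intro iffI conjI allI) simp_all

lemma trilinear_map_iff:
  "trilinear_map s sV f \<longleftrightarrow> vector_space s \<and> vector_space sV \<and>
     (\<forall>x x' y z. f (x + x') y z = f x y z + f x' y z) \<and> (\<forall>c x y z. f (s c x) y z = sV c (f x y z)) \<and>
     (\<forall>x y y' z. f x (y + y') z = f x y z + f x y' z) \<and> (\<forall>c x y z. f x (s c y) z = sV c (f x y z)) \<and>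
     (\<forall>x y z z'. f x y (z + z') = f x y z + f x y z') \<and> (\<forall>c x y z. f x y (s c z) = sV c (f x y z))"
  unfolding trilinear_map_def Vector_Spaces.linear_iff by (intro iffI conjI allI) simp_all

lemma bilinear_map_tens2:
  assumes "vector_space s"
  shows "bilinear_map s fscale (tens2 s)"
  unfolding bilinear_map_iff[of s fscale]
  by (intro conjI allI ext assms vector_space_fscale)
    (simp_all add: tens2_def fscale_def bilinear_map_iff[of s "(*)"])

lemma trilinear_map_tens3:
  assumes "vector_space s"
  shows "trilinear_map s fscale (tens3 s)"
  unfolding trilinear_map_iff[of s fscale]
  by (intro conjI allI ext assms vector_space_fscale)
    (simp_all add: tens3_def fscale_def trilinear_map_iff[of s "(*)"])

lemma sum_tens2_apply:
  "(\<Sum>(u, v)\<leftarrow>us. tens2 s u v) B = (\<Sum>(u, v)\<leftarrow>us. tens2 s u v B)"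
  by (induction us) auto

lemma linear_form_separates:
  assumes "vector_space sV" and "w \<noteq> 0"
  obtains \<phi> where "Vector_Spaces.linear sV (*) \<phi>" and "\<phi> w \<noteq> 0"
proof -
  interpret V: vector_space sV by fact
  interpret VK: vector_space_pair sV "(*)"
    using assms(1) vector_space_times by (simp add: vector_space_pair_def)
  have "\<exists>g. Vector_Spaces.linear sV (*) g \<and> (\<forall>x\<in>{w}. g x = 1)"
    by (rule VK.linear_independent_extend) (use assms(2) in auto)
  then show ?thesis using that by (metis insertI1 zero_neq_one)
qed

text \<open>A bilinear map out of \<open>A \<times> A\<close> takes equal values on equal formal sums of tensors.\<close>

lemma bilinear_map_tens2_cong:
  assumes f: "bilinear_map s sV f"
    and eq: "(\<Sum>(u, v)\<leftarrow>us. tens2 s u v) = (\<Sum>(u, v)\<leftarrow>vs. tens2 s u v)"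
  shows "(\<Sum>(u, v)\<leftarrow>us. f u v) = (\<Sum>(u, v)\<leftarrow>vs. f u v)"
proof (rule ccontr)
  let ?w = "(\<Sum>(u, v)\<leftarrow>us. f u v) - (\<Sum>(u, v)\<leftarrow>vs. f u v)"
  assume "\<not> ?thesis"
  then have "?w \<noteq> 0" by simp
  moreover have "vector_space sV"
    using f by (simp add: bilinear_map_iff)
  ultimately obtain \<phi> where lin: "Vector_Spaces.linear sV (*) \<phi>" and nz: "\<phi> ?w \<noteq> 0"
    by (meson linear_form_separates)
  have bil: "bilinear_map s (*) (\<lambda>u v. \<phi> (f u v))"
    using f lin unfolding bilinear_map_iff Vector_Spaces.linear_iff by simp
  have "(\<Sum>(u, v)\<leftarrow>us. \<phi> (f u v)) = (\<Sum>(u, v)\<leftarrow>vs. \<phi> (f u v))"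
    using arg_cong[OF eq, of "\<lambda>t. t (\<lambda>u v. \<phi> (f u v))"] bil
    by (simp add: sum_tens2_apply) (simp add: tens2_def)
  then have "\<phi> ?w = 0"
    using Modules.module_hom.diff[OF lin[unfolded Vector_Spaces.linear_iff_module_hom]]
    by (simp add: linear_sum_list[OF lin])
  with nz show False ..
qed

lemma tensor_lift_sum:
  assumes "bilinear_map s sV f"
  shows "tensor_lift s f (\<Sum>(u, v)\<leftarrow>us. tens2 s u v) = (\<Sum>(u, v)\<leftarrow>us. f u v)"
  unfolding tensor_lift_def
  by (rule the_equality) (use bilinear_map_tens2_cong[OF assms] in blast)+

lemma tensor2_space_iff:
  assumes "vector_space s"
  shows "t \<in> tensor2_space s \<longleftrightarrow> (\<exists>us. t = (\<Sum>(u, v)\<leftarrow>us. tens2 s u v))"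
proof
  interpret F: vector_space "fscale :: 'a \<Rightarrow> (('b \<Rightarrow> 'b \<Rightarrow> 'a) \<Rightarrow> 'a) \<Rightarrow> ('b \<Rightarrow> 'b \<Rightarrow> 'a) \<Rightarrow> 'a"
    by (rule vector_space_fscale)
  have sc: "fscale c (tens2 s x y) = tens2 s (s c x) y" for c x y
    using bilinear_map_tens2[OF assms] unfolding bilinear_map_iff by metis
  show "\<exists>us. t = (\<Sum>(u, v)\<leftarrow>us. tens2 s u v)" if "t \<in> tensor2_space s"
    using that[unfolded tensor2_space_def]
  proof (induction rule: F.span_induct_alt)
    case base
    have "0 = (\<Sum>(u, v)\<leftarrow>[]. tens2 s u v)" by simp
    then show ?case by blast
  next
    case (step c x y)
    then obtain a b us where "x = tens2 s a b" "y = (\<Sum>(u, v)\<leftarrow>us. tens2 s u v)" by blast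
    then have "fscale c x + y = (\<Sum>(u, v)\<leftarrow>(s c a, b) # us. tens2 s u v)"
      unfolding list.map sum_list.Cons prod.case by (simp only: sc)
    then show ?case by blast
  qed
  show "t \<in> tensor2_space s" if "\<exists>us. t = (\<Sum>(u, v)\<leftarrow>us. tens2 s u v)"
  proof -
    from that obtain us where "t = (\<Sum>(u, v)\<leftarrow>us. tens2 s u v)" by blast
    moreover have "(\<Sum>(u, v)\<leftarrow>us. tens2 s u v) \<in> tensor2_space s"
      unfolding tensor2_space_def
    proof (induction us)
      case Nil
      show ?case unfolding list.map sum_list.Nil by (rule F.span_zero)
    next
      case (Cons p us)
      obtain a b where p: "p = (a, b)" by fastforce
      have "tens2 s a b \<in> F.span {tens2 s x y | x y. True}"
        by (rule F.span_base) blast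
      from F.span_add[OF this Cons.IH] show ?case
        unfolding p list.map sum_list.Cons prod.case .
    qed
    ultimately show ?thesis by simp
  qed
qed


section \<open>Left Alia algebras and coalgebras\<close>

locale left_alia_algebra = vector_space scale
  for scale :: "'k::field_char_0 \<Rightarrow> 'a::ab_group_add \<Rightarrow> 'a" +
  fixes br :: "'a \<Rightarrow> 'a \<Rightarrow> 'a"
  assumes br_bilinear: "bilinear_map scale scale br"
    and left_alia:
      "br (br x y) z + br (br y z) x + br (br z x) y = br (br y x) z + br (br z y) x + br (br x z) y"

text \<open>\<open>sweedler3 s \<Delta> f x\<close> is \<open>f x\<^sub>(\<^sub>1\<^sub>)\<^sub>(\<^sub>1\<^sub>) x\<^sub>(\<^sub>1\<^sub>)\<^sub>(\<^sub>2\<^sub>) x\<^sub>(\<^sub>2\<^sub>)\<close> in Sweedler notation.\<close>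

definition sweedler3 ::
    "('k::field \<Rightarrow> 'a::ab_group_add \<Rightarrow> 'a) \<Rightarrow> ('a \<Rightarrow> ('a, 'k) tensor2) \<Rightarrow>
     ('a \<Rightarrow> 'a \<Rightarrow> 'a \<Rightarrow> 'v::comm_monoid_add) \<Rightarrow> 'a \<Rightarrow> 'v" where
  "sweedler3 s \<Delta> f x =
     tensor_lift s (\<lambda>x1 x2. tensor_lift s (\<lambda>x11 x12. f x11 x12 x2) (\<Delta> x1)) (\<Delta> x)"

locale left_alia_coalgebra = vector_space scale
  for scale :: "'k::field_char_0 \<Rightarrow> 'a::ab_group_add \<Rightarrow> 'a" +
  fixes \<Delta> :: "'a \<Rightarrow> ('a, 'k) tensor2"
  assumes comult_in: "\<Delta> x \<in> tensor2_space scale"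
    and comult_linear: "Vector_Spaces.linear scale fscale \<Delta>"
    and left_alia_co:
      "sweedler3 scale \<Delta> (\<lambda>x11 x12 x2. tens3 scale x12 x11 x2) x
         + sweedler3 scale \<Delta> (\<lambda>x11 x12 x2. tens3 scale x11 x2 x12) x
         + sweedler3 scale \<Delta> (\<lambda>x11 x12 x2. tens3 scale x2 x12 x11) x
       = sweedler3 scale \<Delta> (\<lambda>x11 x12 x2. tens3 scale x11 x12 x2) x
         + sweedler3 scale \<Delta> (\<lambda>x11 x12 x2. tens3 scale x12 x2 x11) x
         + sweedler3 scale \<Delta> (\<lambda>x11 x12 x2. tens3 scale x2 x11 x12) x"

locale nijenhuis_left_alia_coalgebra = left_alia_coalgebra scale \<Delta>
  for scale :: "'k::field_char_0 \<Rightarrow> 'a::ab_group_add \<Rightarrow> 'a" and \<Delta> +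
  fixes S :: "'a \<Rightarrow> 'a"
  assumes S_linear: "Vector_Spaces.linear scale scale S"
    and nijenhuis:
      "tensor_map scale S S (\<Delta> x) + \<Delta> (S (S x))
       = tensor_map scale S id (\<Delta> (S x)) + tensor_map scale id S (\<Delta> (S x))"

definition antisymmetric_tensor :: "('k::field \<Rightarrow> 'a::ab_group_add \<Rightarrow> 'a) \<Rightarrow> ('a, 'k) tensor2 \<Rightarrow> bool" where
  "antisymmetric_tensor s r \<longleftrightarrow> r \<in> tensor2_space s \<and> r + tensor_flip s r = 0"

locale cosymplectic_left_alia_coalgebra = left_alia_coalgebra scale \<Delta>
  for scale :: "'k::field_char_0 \<Rightarrow> 'a::ab_group_add \<Rightarrow> 'a" and \<Delta> +
  fixes r :: "('a, 'k) tensor2"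
  assumes r_antisymmetric: "antisymmetric_tensor scale r"
    and cosymplectic:
      "tensor_lift scale (\<lambda>a b. tensor_lift scale (\<lambda>a1 a2.
           tens3 scale a1 a2 b - tens3 scale a2 a1 b - tens3 scale a2 b a1 + tens3 scale b a2 a1)
         (\<Delta> a)) r = 0"


section \<open>Left Alia bialgebras\<close>

locale left_alia_bialgebra =
  left_alia_algebra scale br + left_alia_coalgebra scale \<Delta>
  for scale :: "'k::field_char_0 \<Rightarrow> 'a::ab_group_add \<Rightarrow> 'a" and br \<Delta> +
  assumes compatible:
    "tensor_flip scale (\<Delta> (br x y - br y x)) - \<Delta> (br x y - br y x)
     = tensor_flip scale
         (tensor_map scale (\<lambda>z. br z y) id (\<Delta> x) - tensor_map scale (\<lambda>z. br z x) id (\<Delta> y))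
       - (tensor_map scale (\<lambda>z. br z y) id (\<Delta> x) - tensor_map scale (\<lambda>z. br z x) id (\<Delta> y))"

definition left_alia_YBE ::
    "('k::field \<Rightarrow> 'a::ab_group_add \<Rightarrow> 'a) \<Rightarrow> ('a \<Rightarrow> 'a \<Rightarrow> 'a) \<Rightarrow> ('a, 'k) tensor2 \<Rightarrow> bool" where
  "left_alia_YBE s br r \<longleftrightarrow>
     tensor_lift s (\<lambda>ai bi. tensor_lift s (\<lambda>aj bj.
         tens3 s (br ai aj) bi bj + tens3 s ai (br aj bi - br bi aj) bj - tens3 s ai aj (br bj bi))
       r) r = 0"

definition comult_of ::
    "('k::field \<Rightarrow> 'a::ab_group_add \<Rightarrow> 'a) \<Rightarrow> ('a \<Rightarrow> 'a \<Rightarrow> 'a) \<Rightarrow> ('a, 'k) tensor2 \<Rightarrow> 'a \<Rightarrow> ('a, 'k) tensor2" where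
  "comult_of s br r x = tensor_lift s (\<lambda>a b. tens2 s (br a x - br x a) b - tens2 s a (br b x)) r"

text \<open>\<open>triangular_left_alia_bialgebra s br r\<close> is about \<open>(A, [,], \<Delta>\<^sub>r)\<close>.\<close>

definition triangular_left_alia_bialgebra ::
    "('k::field_char_0 \<Rightarrow> 'a::ab_group_add \<Rightarrow> 'a) \<Rightarrow> ('a \<Rightarrow> 'a \<Rightarrow> 'a) \<Rightarrow> ('a, 'k) tensor2 \<Rightarrow> bool" where
  "triangular_left_alia_bialgebra s br r \<longleftrightarrow>
     left_alia_bialgebra s br (comult_of s br r) \<and> antisymmetric_tensor s r \<and> left_alia_YBE s br r"

definition co_left_alia_YBE ::
    "('k::field \<Rightarrow> 'a::ab_group_add \<Rightarrow> 'a) \<Rightarrow> ('a \<Rightarrow> ('a, 'k) tensor2) \<Rightarrow> ('a \<Rightarrow> 'a \<Rightarrow> 'k) \<Rightarrow> bool" where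
  "co_left_alia_YBE s \<Delta> \<omega> \<longleftrightarrow> (\<forall>x y z.
     tensor_lift s (\<lambda>x1 x2. \<omega> x1 y * \<omega> x2 z) (\<Delta> x) + tensor_lift s (\<lambda>y1 y2. \<omega> x y2 * \<omega> y1 z) (\<Delta> y)
     = tensor_lift s (\<lambda>y1 y2. \<omega> x y1 * \<omega> y2 z) (\<Delta> y) + tensor_lift s (\<lambda>z1 z2. \<omega> x z2 * \<omega> y z1) (\<Delta> z))"

definition bracket_of ::
    "('k::field \<Rightarrow> 'a::ab_group_add \<Rightarrow> 'a) \<Rightarrow> ('a \<Rightarrow> ('a, 'k) tensor2) \<Rightarrow> ('a \<Rightarrow> 'a \<Rightarrow> 'k) \<Rightarrow> 'a \<Rightarrow> 'a \<Rightarrow> 'a" where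
  "bracket_of s \<Delta> \<omega> x y =
     tensor_lift s (\<lambda>x1 x2. s (\<omega> x1 y) x2) (\<Delta> x) - tensor_lift s (\<lambda>x1 x2. s (\<omega> x2 y) x1) (\<Delta> x)
     - tensor_lift s (\<lambda>y1 y2. s (\<omega> x y1) y2) (\<Delta> y)"

text \<open>\<open>dual_triangular_left_alia_bialgebra s \<Delta> \<omega>\<close> is about \<open>(A, [,]\<^sub>\<omega>, \<Delta>)\<close>.\<close>

definition dual_triangular_left_alia_bialgebra ::
    "('k::field_char_0 \<Rightarrow> 'a::ab_group_add \<Rightarrow> 'a) \<Rightarrow> ('a \<Rightarrow> ('a, 'k) tensor2) \<Rightarrow> ('a \<Rightarrow> 'a \<Rightarrow> 'k) \<Rightarrow> bool" where
  "dual_triangular_left_alia_bialgebra s \<Delta> \<omega> \<longleftrightarrow>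
     left_alia_bialgebra s (bracket_of s \<Delta> \<omega>) \<Delta> \<and>
     bilinear_map s (*) \<omega> \<and> (\<forall>x y. \<omega> x y = - \<omega> y x) \<and> co_left_alia_YBE s \<Delta> \<omega>"

definition contract ::
    "('k::field \<Rightarrow> 'a::ab_group_add \<Rightarrow> 'a) \<Rightarrow> ('a, 'k) tensor2 \<Rightarrow> ('a \<Rightarrow> 'a \<Rightarrow> 'k) \<Rightarrow> 'a \<Rightarrow> 'a" where
  "contract s r \<omega> x = tensor_lift s (\<lambda>a b. s (\<omega> b x) a) r"

end

theory Submission
  imports Defs
begin

text \<open>
  The proof dualises. On linear forms on \<open>A\<close>, write \<open>f \<star> g\<close> for the product dual to \<open>\<Delta>\<close>,
  \<open>R(f, g)\<close> for the skew form \<open>(f \<otimes> g)(r)\<close>, and \<open>\<rho> : A\<^sup>* \<rightarrow> A\<close> for the map with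
  \<open>f (\<rho> g) = R(f, g)\<close>. The form \<open>\<omega>\<close> gives a map \<open>A \<rightarrow> A\<^sup>*\<close>, \<open>x \<mapsto> \<omega>(x, -)\<close>. Put
  \<open>T f = \<omega>(\<rho> f, -)\<close>; up to sign \<open>T\<close> is the transpose of \<open>S\<close>, so the Nijenhuis identity for
  \<open>S\<close> and \<open>\<Delta>\<close> amounts to \<open>T f \<star> T g + T\<^sup>2 (f \<star> g) = T (T f \<star> g + f \<star> T g)\<close>.

  Each of the three defining equations becomes one identity on linear forms:

  \<^item> the co-Yang-Baxter equation says that \<open>x \<mapsto> \<omega>(x, -)\<close> carries \<open>[,]\<^sub>\<omega>\<close> to \<open>\<star>\<close> (\<open>w_br\<close>);
  \<^item> the cosymplectic condition says that \<open>R\<close> is closed on \<open>(A\<^sup>*, \<star>)\<close>, in the sense that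
    \<open>R(f \<star> g - g \<star> f, h) = R(h \<star> f, g) - R(h \<star> g, f)\<close> (\<open>pair_cosymplectic\<close>);
  \<^item> given this, the Yang-Baxter equation for \<open>r\<close> says that the form \<open>R(f, T g) = \<omega>(\<rho> f, \<rho> g)\<close>
    is closed too (\<open>T_closed\<close>).

  The two closedness statements together yield
  \<open>[\<rho> f, \<rho> g]\<^sub>\<omega> + \<rho> (T (f \<star> g)) = \<rho> (T f \<star> g) + \<rho> (f \<star> T g)\<close> (\<open>br_sharp\<close>), and applying
  \<open>x \<mapsto> \<omega>(x, -)\<close> turns this into the Nijenhuis identity for \<open>T\<close>.

  The space \<open>A\<close> may have infinite dimension, so \<open>A\<^sup>* \<otimes> A\<^sup>*\<close> need not exhaust the bilinear forms on
  \<open>A\<close>. It still separates the elements of \<open>A \<otimes> A\<close> (\<open>tensor2_eqI\<close>), which is enough to transport the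
  identity back from \<open>T\<close> to \<open>S\<close>.
\<close>

section \<open>Evaluating tensors at multilinear forms\<close>

abbreviation linear_form :: "('k::field \<Rightarrow> 'a::ab_group_add \<Rightarrow> 'a) \<Rightarrow> ('a \<Rightarrow> 'k) \<Rightarrow> bool" where
  "linear_form s f \<equiv> Vector_Spaces.linear s (*) f"

lemma linear_form_iff:
  "linear_form s f \<longleftrightarrow>
     vector_space s \<and> (\<forall>x y. f (x + y) = f x + f y) \<and> (\<forall>c x. f (s c x) = c * f x)"
  unfolding Vector_Spaces.linear_iff using vector_space_times by auto

lemmas bilinear_form_iff = bilinear_map_iff[where sV = "(*)", simplified vector_space_times]

lemma bilinear_form_mult:
  assumes "linear_form s f" and "linear_form s g"
  shows "bilinear_map s (*) (\<lambda>x y. f x * g y)"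
  using assms unfolding bilinear_form_iff linear_form_iff by (simp add: algebra_simps)

lemma bilinear_form_add:
  assumes "bilinear_map s (*) B" and "bilinear_map s (*) C"
  shows "bilinear_map s (*) (\<lambda>x y. B x y + C x y)"
  using assms unfolding bilinear_form_iff by (simp add: algebra_simps)

lemma bilinear_form_scale:
  assumes "bilinear_map s (*) B"
  shows "bilinear_map s (*) (\<lambda>x y. c * B x y)"
  using assms unfolding bilinear_form_iff by (simp add: algebra_simps)

lemma bilinear_form_minus:
  assumes "bilinear_map s (*) B"
  shows "bilinear_map s (*) (\<lambda>x y. - B x y)"
  using assms unfolding bilinear_form_iff by simp

lemma bilinear_form_diff:
  assumes "bilinear_map s (*) B" and "bilinear_map s (*) C"
  shows "bilinear_map s (*) (\<lambda>x y. B x y - C x y)"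
  using bilinear_form_add[OF assms(1) bilinear_form_minus[OF assms(2)]] by simp

lemmas bilinear_form_intros =
  bilinear_form_mult bilinear_form_add bilinear_form_scale bilinear_form_minus bilinear_form_diff

lemma linear_form_diff:
  assumes "linear_form s f"
  shows "f (x - y) = f x - f y"
  using Modules.module_hom.diff[OF assms[unfolded Vector_Spaces.linear_iff_module_hom]] .

lemma linear_form_neg:
  assumes "linear_form s f"
  shows "f (- x) = - f x"
  using Modules.module_hom.neg[OF assms[unfolded Vector_Spaces.linear_iff_module_hom]] .

lemma trilinear_form_mult:
  assumes "linear_form s f" and "linear_form s g" and "linear_form s h"
  shows "trilinear_map s (*) (\<lambda>x y z. f x * g y * h z)"
  using assms unfolding trilinear_map_iff linear_form_iff
  by (simp add: algebra_simps vector_space_times)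

lemma tensor2_induct [consumes 2, case_names zero add]:
  assumes "vector_space s" and "t \<in> tensor2_space s"
    and zero: "P (\<lambda>B. 0)"
    and add: "\<And>u v t. t \<in> tensor2_space s \<Longrightarrow> P t \<Longrightarrow> P (\<lambda>B. tens2 s u v B + t B)"
  shows "P t"
proof -
  obtain us where t: "t = (\<Sum>(u, v)\<leftarrow>us. tens2 s u v)"
    using assms(1,2) tensor2_space_iff by blast
  have "P (\<Sum>(u, v)\<leftarrow>us. tens2 s u v)"
  proof (induction us)
    case Nil
    then show ?case using zero by (simp add: zero_fun_def)
  next
    case (Cons p us)
    obtain u v where p: "p = (u, v)" by fastforce
    have "(\<Sum>(u, v)\<leftarrow>us. tens2 s u v) \<in> tensor2_space s"
      using assms(1) tensor2_space_iff by blast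
    from add[OF this Cons.IH, of u v] show ?case
      unfolding p by (simp add: plus_fun_def)
  qed
  then show ?thesis using t by simp
qed

lemma tensor2_eval_add:
  assumes "t \<in> tensor2_space s" and "bilinear_map s (*) B" and "bilinear_map s (*) C"
  shows "t (\<lambda>u v. B u v + C u v) = t B + t C"
proof -
  have vs: "vector_space s" using assms(2) by (simp add: bilinear_map_iff)
  note bil = bilinear_form_add[OF assms(2,3)]
  show ?thesis
    using vs assms(1) by (induction rule: tensor2_induct) (simp_all add: tens2_def assms bil)
qed

lemma tensor2_eval_scale:
  assumes "t \<in> tensor2_space s" and "bilinear_map s (*) B"
  shows "t (\<lambda>u v. c * B u v) = c * t B"
proof -
  have vs: "vector_space s" using assms(2) by (simp add: bilinear_map_iff)
  note bil = bilinear_form_scale[OF assms(2)]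
  show ?thesis
    using vs assms(1)
    by (induction rule: tensor2_induct) (simp_all add: tens2_def assms bil algebra_simps)
qed

lemma tensor2_eval_minus:
  assumes "t \<in> tensor2_space s" and "bilinear_map s (*) B"
  shows "t (\<lambda>u v. - B u v) = - t B"
  using tensor2_eval_scale[OF assms, of "-1"] by simp

lemma tensor2_eval_diff:
  assumes "t \<in> tensor2_space s" and "bilinear_map s (*) B" and "bilinear_map s (*) C"
  shows "t (\<lambda>u v. B u v - C u v) = t B - t C"
  using tensor2_eval_add[OF assms(1,2) bilinear_form_minus[OF assms(3)]]
    tensor2_eval_minus[OF assms(1,3)] by simp

lemmas tensor2_eval_simps =
  tensor2_eval_add tensor2_eval_scale tensor2_eval_minus tensor2_eval_diff

text \<open>
  A tensor is its own evaluation functional, so a lift is known once linear maps are pushed through it;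
  computations with Sweedler sums then become evaluations of \<open>t\<close> at explicit forms.
\<close>

lemma tensor2_eval_lift:
  assumes t: "t \<in> tensor2_space s" and f: "bilinear_map s sV f"
    and \<phi>: "Vector_Spaces.linear sV (*) \<phi>"
  shows "\<phi> (tensor_lift s f t) = t (\<lambda>u v. \<phi> (f u v))"
proof -
  have vs: "vector_space s" using f by (simp add: bilinear_map_iff)
  obtain us where us: "t = (\<Sum>(u, v)\<leftarrow>us. tens2 s u v)"
    using vs t tensor2_space_iff by blast
  have "bilinear_map s (*) (\<lambda>u v. \<phi> (f u v))"
    using f \<phi> unfolding bilinear_map_iff Vector_Spaces.linear_iff by simp
  then show ?thesis
    unfolding us tensor_lift_sum[OF f] linear_sum_list[OF \<phi>] sum_tens2_apply
    by (simp add: tens2_def)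
qed

lemma tensor_lift_form:
  assumes "t \<in> tensor2_space s" and "bilinear_map s (*) B"
  shows "tensor_lift s B t = t B"
  using tensor2_eval_lift[OF assms, of "\<lambda>x. x"] vector_space_times
  by (simp add: Vector_Spaces.linear_iff)

text \<open>
  The target \<open>A \<otimes> A \<otimes> A\<close> (or \<open>A \<otimes> A\<close>) is a space of functions of forms, so a lift into it can be
  computed form by form. This reduces every tensor identity to one between scalars.
\<close>

lemma bilinear_map_fscaleI:
  assumes "\<And>T. bilinear_map s (*) (\<lambda>u v. F u v T)"
  shows "bilinear_map s fscale F"
  using assms unfolding bilinear_map_iff
  by (simp add: fun_eq_iff fscale_def vector_space_fscale)

lemma tensor_lift_apply:
  assumes "t \<in> tensor2_space s" and "\<And>T. bilinear_map s (*) (\<lambda>u v. F u v T)"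
  shows "tensor_lift s F t T = t (\<lambda>u v. F u v T)"
proof (rule tensor2_eval_lift[OF assms(1) bilinear_map_fscaleI[OF assms(2)], where \<phi> = "\<lambda>F. F T"])
  show "Vector_Spaces.linear fscale (*) (\<lambda>F. F T)"
    unfolding Vector_Spaces.linear_iff
    by (simp add: vector_space_fscale vector_space_times fscale_def)
qed

lemma bilinear_map_tens2_apply:
  assumes "vector_space s"
  shows "bilinear_map s (*) (\<lambda>u v. tens2 s u v B)"
  using assms unfolding tens2_def by (auto simp: bilinear_form_iff)

lemma trilinear_map_tens3_apply:
  assumes "vector_space s"
  shows "trilinear_map s (*) (\<lambda>x y z. tens3 s x y z T)"
  using assms unfolding tens3_def by (auto simp: trilinear_map_iff vector_space_times)

lemma bilinear_map_tensor2_eval: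
  assumes t: "t \<in> tensor2_space s"
    and in_outer: "\<And>p q. bilinear_map s (*) (\<lambda>u v. H u v p q)"
    and in_inner: "\<And>u v. bilinear_map s (*) (H u v)"
  shows "bilinear_map s (*) (\<lambda>u v. t (H u v))"
proof -
  have vs: "vector_space s" using in_inner by (simp add: bilinear_map_iff)
  have "H (x + y) z = (\<lambda>p q. H x z p q + H y z p q)" "H x (y + z) = (\<lambda>p q. H x y p q + H x z p q)"
    "H (s c x) z = (\<lambda>p q. c * H x z p q)" "H x (s c z) = (\<lambda>p q. c * H x z p q)" for x y z c
    using in_outer unfolding bilinear_form_iff by (auto simp: fun_eq_iff)
  then show ?thesis
    unfolding bilinear_form_iff
    by (simp add: vs tensor2_eval_add[OF t in_inner in_inner] tensor2_eval_scale[OF t in_inner])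
qed

text \<open>
  This and the previous lemma show that the outer lift in a nested Sweedler expression is taken of
  a bilinear map: there the inner tensor is fixed, here it depends on the outer variable through \<open>\<Delta>\<close>.
\<close>

lemma bilinear_map_comult_eval:
  assumes \<Delta>: "\<And>x. \<Delta> x \<in> tensor2_space s" "Vector_Spaces.linear s fscale \<Delta>"
    and T: "trilinear_map s (*) T"
  shows "bilinear_map s (*) (\<lambda>a b. \<Delta> a (\<lambda>a1 a2. T a1 a2 b))"
proof -
  have bil: "bilinear_map s (*) (\<lambda>a1 a2. T a1 a2 b)" for b
    using T unfolding trilinear_map_iff bilinear_form_iff by simp
  have "(\<lambda>a1 a2. T a1 a2 (b + b')) = (\<lambda>a1 a2. T a1 a2 b + T a1 a2 b')"
    "(\<lambda>a1 a2. T a1 a2 (s c b)) = (\<lambda>a1 a2. c * T a1 a2 b)" for b b' c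
    using T unfolding trilinear_map_iff by auto
  then show ?thesis
    using \<Delta>(2) unfolding bilinear_form_iff Vector_Spaces.linear_iff
    by (simp add: tensor2_eval_add[OF \<Delta>(1) bil bil] tensor2_eval_scale[OF \<Delta>(1) bil] fscale_def)
qed

text \<open>
  On the finitely many vectors \<open>u\<close> of a representation \<open>\<Sum> u \<otimes> v\<close>, a bilinear form \<open>B\<close> is the finite
  sum \<open>\<Sum>\<^sub>e e\<^sup>*(u) B(e, v)\<close> over a basis, where \<open>e\<^sup>*\<close> denotes the coordinate along \<open>e\<close>. So although
  \<open>B\<close> itself need not be a finite sum of products of linear forms, products suffice to separate
  tensors.
\<close>

lemma tensor2_eqI:
  assumes vs: "vector_space s"
    and t: "t \<in> tensor2_space s" and t': "t' \<in> tensor2_space s"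
    and eq: "\<And>f g. linear_form s f \<Longrightarrow> linear_form s g \<Longrightarrow>
      t (\<lambda>u v. f u * g v) = t' (\<lambda>u v. f u * g v)"
  shows "t = t'"
proof
  fix B
  interpret V: vector_space s by (rule vs)
  define E where "E = V.extend_basis {}"
  have E: "V.independent E" "V.span E = UNIV"
    unfolding E_def using V.independent_extend_basis V.span_extend_basis V.independent_empty by auto
  define co where "co e u = V.representation E u e" for e u
  have co: "linear_form s (co e)" for e
    unfolding linear_form_iff co_def
    using E by (simp add: vs V.representation_add V.representation_scale)
  \<comment> \<open>The expansion must hold over all large enough finite sets of basis vectors, so that one set
    serves both tensors and every summand of a representation.\<close>
  have supp: "\<exists>F. finite F \<and> (\<forall>G. finite G \<longrightarrow> F \<subseteq> G \<longrightarrow>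
      t B = (\<Sum>e\<in>G. t (\<lambda>u v. co e u * B e v)))"
    if B: "bilinear_map s (*) B" and "t \<in> tensor2_space s" for t
    using vs that(2)
  proof (induction rule: tensor2_induct)
    case zero
    then show ?case by auto
  next
    case (add u v t)
    from add.IH obtain F where F: "finite F" "\<forall>G. finite G \<longrightarrow> F \<subseteq> G \<longrightarrow>
        t B = (\<Sum>e\<in>G. t (\<lambda>u v. co e u * B e v))" by blast
    let ?U = "{e. co e u \<noteq> 0}"
    have finU: "finite ?U" unfolding co_def by (rule V.finite_representation)
    have lin1: "linear_form s (\<lambda>u. B u v)"
      and lin2: "\<And>e. linear_form s (B e)"
      using B unfolding bilinear_form_iff linear_form_iff by auto
    have "B u v = (\<Sum>e\<in>G. co e u * B e v)" if "finite G" "?U \<subseteq> G" for G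
    proof -
      have "u = (\<Sum>e\<in>?U. s (co e u) e)"
        unfolding co_def using V.sum_nonzero_representation_eq[of E u] E by simp
      also have "\<dots> = (\<Sum>e\<in>G. s (co e u) e)"
        by (rule sum.mono_neutral_left) (use that in auto)
      finally have "B u v = B (\<Sum>e\<in>G. s (co e u) e) v"
        by (rule arg_cong[where f = "\<lambda>u. B u v"])
      also have "\<dots> = (\<Sum>e\<in>G. B (s (co e u) e) v)"
        by (rule Modules.module_hom.sum[OF lin1[unfolded Vector_Spaces.linear_iff_module_hom]])
      finally show ?thesis using lin1 unfolding linear_form_iff by simp
    qed
    then have "tens2 s u v B = (\<Sum>e\<in>G. tens2 s u v (\<lambda>u v. co e u * B e v))"
      if "finite G" "?U \<subseteq> G" for G
      using that B by (simp add: tens2_def bilinear_form_mult[OF co lin2])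
    then show ?case
      using F finU by (intro exI[of _ "F \<union> ?U"]) (simp add: sum.distrib)
  qed
  show "t B = t' B"
  proof (cases "bilinear_map s (*) B")
    case True
    obtain F where F: "finite F" "\<forall>G. finite G \<longrightarrow> F \<subseteq> G \<longrightarrow>
        t B = (\<Sum>e\<in>G. t (\<lambda>u v. co e u * B e v))"
      using supp[OF True t] by blast
    obtain F' where F': "finite F'" "\<forall>G. finite G \<longrightarrow> F' \<subseteq> G \<longrightarrow>
        t' B = (\<Sum>e\<in>G. t' (\<lambda>u v. co e u * B e v))"
      using supp[OF True t'] by blast
    have "linear_form s (B e)" for e
      using True unfolding bilinear_form_iff linear_form_iff by auto
    then show ?thesis
      using F(2)[rule_format, of "F \<union> F'"] F'(2)[rule_format, of "F \<union> F'"] F(1) F'(1) eq[OF co]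
      by simp
  next
    case False
    have zero: "t B = 0" if "t \<in> tensor2_space s" for t
      using vs that by (induction rule: tensor2_induct) (simp_all add: tens2_def False)
    show ?thesis by (simp add: zero t t')
  qed
qed

lemma tensor2_space_add:
  assumes "vector_space s" and "t \<in> tensor2_space s" and "t' \<in> tensor2_space s"
  shows "t + t' \<in> tensor2_space s"
proof -
  interpret F: vector_space "fscale :: 'a \<Rightarrow> (('b \<Rightarrow> 'b \<Rightarrow> 'a) \<Rightarrow> 'a) \<Rightarrow> ('b \<Rightarrow> 'b \<Rightarrow> 'a) \<Rightarrow> 'a"
    by (rule vector_space_fscale)
  show ?thesis using assms(2,3) unfolding tensor2_space_def by (rule F.span_add)
qed

lemma bilinear_map_tens2_comp:
  assumes "Vector_Spaces.linear s s f" and "Vector_Spaces.linear s s g"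
  shows "bilinear_map s fscale (\<lambda>u v. tens2 s (f u) (g v))"
proof -
  have "vector_space s" using assms(1) by (simp add: Vector_Spaces.linear_iff)
  from bilinear_map_tens2[OF this] assms show ?thesis
    unfolding bilinear_map_iff Vector_Spaces.linear_iff by simp
qed

lemma tensor_map_in_space:
  assumes f: "Vector_Spaces.linear s s f" and g: "Vector_Spaces.linear s s g"
    and t: "t \<in> tensor2_space s"
  shows "tensor_map s f g t \<in> tensor2_space s"
proof -
  have vs: "vector_space s" using f by (simp add: Vector_Spaces.linear_iff)
  obtain us where us: "t = (\<Sum>(u, v)\<leftarrow>us. tens2 s u v)"
    using vs t tensor2_space_iff by blast
  have "tensor_map s f g t = (\<Sum>(u, v)\<leftarrow>us. tens2 s (f u) (g v))"
    unfolding tensor_map_def us by (rule tensor_lift_sum[OF bilinear_map_tens2_comp[OF f g]])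
  also have "\<dots> = (\<Sum>(u, v)\<leftarrow>map (\<lambda>(u, v). (f u, g v)) us. tens2 s u v)"
    by (simp add: comp_def case_prod_unfold)
  finally show ?thesis using vs tensor2_space_iff by blast
qed

lemma tensor_map_apply:
  assumes f: "Vector_Spaces.linear s s f" and g: "Vector_Spaces.linear s s g"
    and t: "t \<in> tensor2_space s" and B: "bilinear_map s (*) B"
  shows "tensor_map s f g t B = t (\<lambda>u v. B (f u) (g v))"
proof -
  have vs: "vector_space s" using f by (simp add: Vector_Spaces.linear_iff)
  have "bilinear_map s (*) (\<lambda>u v. tens2 s (f u) (g v) C)" for C
    using bilinear_map_tens2_apply[OF vs, of C] f g
    unfolding bilinear_form_iff Vector_Spaces.linear_iff by simp
  from tensor_lift_apply[where F = "\<lambda>u v. tens2 s (f u) (g v)", OF t this] show ?thesis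
    unfolding tensor_map_def by (simp add: tens2_def B)
qed

lemma tensor_flip_apply:
  assumes vs: "vector_space s" and t: "t \<in> tensor2_space s" and B: "bilinear_map s (*) B"
  shows "tensor_flip s t B = t (\<lambda>u v. B v u)"
proof -
  have "bilinear_map s (*) (\<lambda>u v. tens2 s v u C)" for C
    using bilinear_map_tens2_apply[OF vs, of C] unfolding bilinear_form_iff by simp
  from tensor_lift_apply[where F = "\<lambda>u v. tens2 s v u", OF t this] show ?thesis
    unfolding tensor_flip_def by (simp add: tens2_def B)
qed


lemma trilinear_map_diff_middle:
  assumes "trilinear_map s sV T"
  shows "T x (y - y') z = T x y z - T x y' z"
proof -
  have "T x (y - y' + y') z = T x (y - y') z + T x y' z"
    using assms unfolding trilinear_map_iff by metis
  then show ?thesis by simp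
qed

lemma linear_form_eqI:
  assumes "vector_space s" and "\<And>f. linear_form s f \<Longrightarrow> f x = f y"
  shows "x = y"
proof (rule ccontr)
  assume "x \<noteq> y"
  then have "x - y \<noteq> 0" by simp
  then obtain f where f: "linear_form s f" and "f (x - y) \<noteq> 0"
    using linear_form_separates[OF assms(1)] by metis
  then show False using assms(2)[OF f] by (simp add: linear_form_diff[OF f])
qed


section \<open>The dual algebra of a left Alia coalgebra\<close>

context left_alia_coalgebra
begin

definition conv :: "('a \<Rightarrow> 'k) \<Rightarrow> ('a \<Rightarrow> 'k) \<Rightarrow> 'a \<Rightarrow> 'k" (infixl "\<star>" 70) where
  "(f \<star> g) x = \<Delta> x (\<lambda>u v. f u * g v)"

lemma linear_form_conv [simp]: "linear_form scale (f \<star> g)"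
  using comult_linear unfolding linear_form_iff Vector_Spaces.linear_iff conv_def
  by (simp add: fscale_def vector_space_times)

lemma conv_minus:
  assumes "linear_form scale f" and "linear_form scale g"
  shows "(\<lambda>x. - f x) \<star> g = (\<lambda>x. - (f \<star> g) x)" and "f \<star> (\<lambda>x. - g x) = (\<lambda>x. - (f \<star> g) x)"
  using tensor2_eval_minus[OF comult_in bilinear_form_mult[OF assms]]
  by (simp_all add: fun_eq_iff conv_def)

end

context cosymplectic_left_alia_coalgebra
begin

definition pair :: "('a \<Rightarrow> 'k) \<Rightarrow> ('a \<Rightarrow> 'k) \<Rightarrow> 'k" where
  "pair f g = r (\<lambda>a b. f a * g b)"

definition sharp :: "('a \<Rightarrow> 'k) \<Rightarrow> 'a" where
  "sharp g = tensor_lift scale (\<lambda>a b. scale (g b) a) r"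

lemmas vs = vector_space_axioms

lemma r_in: "r \<in> tensor2_space scale"
  using r_antisymmetric by (simp add: antisymmetric_tensor_def)

text \<open>\<open>sharp\<close> is the map \<open>\<rho>\<close> that turns forms into vectors, and this is its defining property.\<close>

lemma linear_form_sharp:
  assumes "linear_form scale f" and "linear_form scale g"
  shows "f (sharp g) = pair f g"
proof -
  have "bilinear_map scale scale (\<lambda>a b. scale (g b) a)"
    using assms(2) unfolding bilinear_map_iff linear_form_iff
    by (simp add: vs scale_right_distrib scale_left_distrib mult.commute)
  from tensor2_eval_lift[OF r_in this assms(1)] show ?thesis
    using assms(1) unfolding sharp_def pair_def linear_form_iff by (simp add: mult.commute)
qed

lemma pair_skew:
  assumes "linear_form scale f" and "linear_form scale g"
  shows "pair f g = - pair g f"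
proof -
  have "(r + tensor_flip scale r) (\<lambda>a b. f a * g b) = 0"
    using r_antisymmetric by (simp add: antisymmetric_tensor_def)
  then show ?thesis
    unfolding pair_def
    by (simp add: tensor_flip_apply[OF vs r_in bilinear_form_mult[OF assms]] mult.commute
        eq_neg_iff_add_eq_0)
qed

text \<open>
  The cosymplectic equation evaluated at \<open>f \<otimes> g \<otimes> h\<close>: the coproduct inside becomes \<open>\<star>\<close>, and the
  outer sum over \<open>r\<close> becomes the pairing.
\<close>

lemma pair_cosymplectic:
  assumes f: "linear_form scale f" and g: "linear_form scale g" and h: "linear_form scale h"
  shows "pair (f \<star> g) h - pair (g \<star> f) h = pair (h \<star> f) g - pair (h \<star> g) f"
proof -
  let ?F = "\<lambda>a1 a2 b. tens3 scale a1 a2 b - tens3 scale a2 a1 b - tens3 scale a2 b a1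
    + tens3 scale b a2 a1"
  have tri: "trilinear_map scale (*) (\<lambda>a1 a2 b. ?F a1 a2 b T)" for T
    using trilinear_map_tens3_apply[OF vs, of T] unfolding trilinear_map_iff
    by (simp add: algebra_simps)
  have bil: "bilinear_map scale (*) (\<lambda>a1 a2. ?F a1 a2 b T)" for b T
    using tri[of T] unfolding trilinear_map_iff bilinear_form_iff by simp
  have lift_inner: "tensor_lift scale (\<lambda>a1 a2. ?F a1 a2 b) (\<Delta> a) T
      = \<Delta> a (\<lambda>a1 a2. ?F a1 a2 b T)" for a b T
    by (rule tensor_lift_apply[OF comult_in bil])
  have lift_outer: "tensor_lift scale (\<lambda>a b. tensor_lift scale (\<lambda>a1 a2. ?F a1 a2 b) (\<Delta> a)) r T
      = r (\<lambda>a b. \<Delta> a (\<lambda>a1 a2. ?F a1 a2 b T))" for T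
    by (subst tensor_lift_apply[OF r_in])
      (simp_all only: lift_inner bilinear_map_comult_eval[OF comult_in comult_linear tri])
  have t3: "tens3 scale x y z (\<lambda>x y z. f x * g y * h z) = f x * g y * h z" for x y z
    by (simp only: tens3_def trilinear_form_mult[OF f g h] if_True)
  have inner: "\<Delta> a (\<lambda>a1 a2. ?F a1 a2 b (\<lambda>x y z. f x * g y * h z))
      = (f \<star> g) a * h b - (g \<star> f) a * h b - (h \<star> f) a * g b + (h \<star> g) a * f b" for a b
  proof -
    have "(\<lambda>a1 a2. ?F a1 a2 b (\<lambda>x y z. f x * g y * h z))
      = (\<lambda>a1 a2. (h b * (f a1 * g a2) - h b * (g a1 * f a2))
          + (f b * (h a1 * g a2) - g b * (h a1 * f a2)))"
      by (intro ext) (simp only: plus_fun_apply minus_apply t3, simp add: algebra_simps)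
    moreover have "\<Delta> a (\<lambda>a1 a2. (h b * (f a1 * g a2) - h b * (g a1 * f a2))
          + (f b * (h a1 * g a2) - g b * (h a1 * f a2)))
      = (h b * (f \<star> g) a - h b * (g \<star> f) a) + (f b * (h \<star> g) a - g b * (h \<star> f) a)"
      by (simp add: f g h tensor2_eval_simps[OF comult_in] bilinear_form_intros conv_def)
    ultimately show ?thesis by (simp add: algebra_simps)
  qed
  have "r (\<lambda>a b. (f \<star> g) a * h b - (g \<star> f) a * h b - (h \<star> f) a * g b + (h \<star> g) a * f b) = 0"
    using lift_outer[of "\<lambda>x y z. f x * g y * h z"] unfolding cosymplectic inner by simp
  then have "pair (f \<star> g) h - pair (g \<star> f) h - pair (h \<star> f) g + pair (h \<star> g) f = 0"
    by (simp add: tensor2_eval_simps[OF r_in] bilinear_form_intros f g h pair_def)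
  then show ?thesis by (simp add: algebra_simps)
qed

end


section \<open>The two Yang-Baxter equations and the Nijenhuis operator\<close>

locale cosymplectic_dual_triangular = cosymplectic_left_alia_coalgebra scale \<Delta> r
  for scale :: "'k::field_char_0 \<Rightarrow> 'a::ab_group_add \<Rightarrow> 'a" and \<Delta> r +
  fixes w :: "'a \<Rightarrow> 'a \<Rightarrow> 'k"
  assumes dual: "dual_triangular_left_alia_bialgebra scale \<Delta> w"
    and triangular: "triangular_left_alia_bialgebra scale (bracket_of scale \<Delta> w) r"
begin

abbreviation br :: "'a \<Rightarrow> 'a \<Rightarrow> 'a" where
  "br \<equiv> bracket_of scale \<Delta> w"

lemma w_bilinear: "bilinear_map scale (*) w"
  and w_skew: "w x y = - w y x"
  and w_coYBE: "co_left_alia_YBE scale \<Delta> w"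
  using dual unfolding dual_triangular_left_alia_bialgebra_def by blast+

lemma linear_form_w [simp]: "linear_form scale (w x)"
  using w_bilinear unfolding bilinear_form_iff linear_form_iff by simp

lemma br_bilinear: "bilinear_map scale scale br"
  using dual unfolding dual_triangular_left_alia_bialgebra_def left_alia_bialgebra_def
    left_alia_algebra_def left_alia_algebra_axioms_def by blast

text \<open>
  Two of the three terms of \<open>[x, y]\<^sub>\<omega>\<close> involve \<open>\<omega>(-, y)\<close>, which is \<open>- \<omega>(y, -)\<close>; this accounts for
  the signs.
\<close>

lemma linear_form_br:
  assumes f: "linear_form scale f"
  shows "f (br x y) = (f \<star> w y) x - (w y \<star> f) x - (w x \<star> f) y"
proof -
  have bil: "bilinear_map scale scale (\<lambda>u v. scale (g u) v)"
    "bilinear_map scale scale (\<lambda>u v. scale (g v) u)" if "linear_form scale g" for g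
    using that unfolding bilinear_map_iff linear_form_iff
    by (simp_all add: vs scale_right_distrib scale_left_distrib mult.commute)
  have lift: "f (tensor_lift scale (\<lambda>u v. scale (g u) v) (\<Delta> z)) = (g \<star> f) z"
    "f (tensor_lift scale (\<lambda>u v. scale (g v) u) (\<Delta> z)) = (f \<star> g) z"
    if g: "linear_form scale g" for g z
    using tensor2_eval_lift[OF comult_in bil(1)[OF g] f]
      tensor2_eval_lift[OF comult_in bil(2)[OF g] f] f
    unfolding conv_def linear_form_iff by (simp_all add: mult.commute)
  have w_left: "linear_form scale (\<lambda>x. w x y)"
    using w_bilinear unfolding bilinear_form_iff linear_form_iff by simp
  have "(\<lambda>x. w x y) = (\<lambda>x. - w y x)"
    using w_skew by blast
  then have "((\<lambda>x. w x y) \<star> f) x = - (w y \<star> f) x" "(f \<star> (\<lambda>x. w x y)) x = - (f \<star> w y) x"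
    using conv_minus[OF linear_form_w f] conv_minus[OF f linear_form_w] by simp_all
  then show ?thesis
    unfolding bracket_of_def by (simp add: lift w_left linear_form_diff[OF f])
qed

text \<open>
  By the co-Yang-Baxter equation at \<open>(y, x, z)\<close>, the three terms of \<open>\<omega>(z, [x, y]\<^sub>\<omega>)\<close>, as expanded in
  \<open>linear_form_br\<close>, combine into one.
\<close>

lemma w_br: "w (br x y) z = (w x \<star> w y) z"
proof -
  have e1: "tensor_lift scale (\<lambda>x1 x2. p x1 * q x2) (\<Delta> x) = (p \<star> q) x"
    if "linear_form scale p" "linear_form scale q" for p q x
    unfolding conv_def by (rule tensor_lift_form[OF comult_in bilinear_form_mult[OF that]])
  have e2: "tensor_lift scale (\<lambda>x1 x2. - (p x1 * q x2)) (\<Delta> x) = - (p \<star> q) x"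
    if "linear_form scale p" "linear_form scale q" for p q x
    using that
    by (simp add: tensor_lift_form[OF comult_in] tensor2_eval_minus[OF comult_in]
        bilinear_form_intros conv_def)
  \<comment> \<open>Skewness brings the components of a coproduct into the second slot of \<open>w\<close>, where \<open>\<star>\<close> expects
    them.\<close>
  have s: "(\<lambda>u v. w u x * w v z) = (\<lambda>u v. w x u * w z v)"
    "(\<lambda>u v. w y v * w u z) = (\<lambda>u v. - (w z u * w y v))"
    "(\<lambda>u v. w y u * w v z) = (\<lambda>u v. - (w y u * w z v))"
    "(\<lambda>u v. w y v * w x u) = (\<lambda>u v. w x u * w y v)" for x y z
    by (auto simp: fun_eq_iff w_skew[of _ x] w_skew[of _ z])
  have "(w x \<star> w z) y - (w z \<star> w y) x = - (w y \<star> w z) x + (w x \<star> w y) z"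
    using w_coYBE[unfolded co_left_alia_YBE_def, rule_format, where x = y and y = x and z = z]
    unfolding s by (simp add: e1 e2)
  then show ?thesis
    using linear_form_br[OF linear_form_w, of z x y] w_skew[of "br x y" z]
    by (simp add: algebra_simps)
qed

text \<open>
  \<open>T\<close> is minus the transpose of the operator \<open>S\<close> (see \<open>linear_form_S\<close>); as the Nijenhuis identity is
  quadratic in the operator, the sign is harmless.
\<close>

definition T :: "('a \<Rightarrow> 'k) \<Rightarrow> 'a \<Rightarrow> 'k" where
  "T f = w (sharp f)"

lemma linear_form_T [simp]: "linear_form scale (T f)"
  by (simp add: T_def)

text \<open>Both sides are \<open>\<omega>(\<rho> f, \<rho> g)\<close>; skewness of \<open>\<omega>\<close> and of the pairing cancel each other.\<close>

lemma pair_T: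
  assumes f: "linear_form scale f" and g: "linear_form scale g"
  shows "pair (T f) g = pair f (T g)"
proof -
  have "pair (T f) g = w (sharp f) (sharp g)"
    using linear_form_sharp[OF linear_form_T g] by (simp add: T_def)
  also have "\<dots> = - pair (T g) f"
    using linear_form_sharp[OF linear_form_T f] w_skew by (metis T_def)
  also have "\<dots> = pair f (T g)"
    using pair_skew[OF f linear_form_T] by simp
  finally show ?thesis .
qed

lemma linear_form_br_sharp:
  assumes f: "linear_form scale f" and g: "linear_form scale g" and h: "linear_form scale h"
  shows "f (br (sharp g) (sharp h)) = pair (f \<star> T h) g - pair (T h \<star> f) g - pair (T g \<star> f) h"
  using linear_form_br[OF f] linear_form_sharp g h by (simp add: T_def[symmetric])

text \<open>
  The Yang-Baxter equation evaluated at \<open>f \<otimes> g \<otimes> h\<close>. Contracting the second leg of \<open>r\<close> with a form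
  \<open>g\<close> gives \<open>\<rho> g\<close>; as \<open>r\<close> is antisymmetric, contracting the first leg gives \<open>- \<rho> g\<close>.
\<close>

lemma YBE_sharp:
  assumes f: "linear_form scale f" and g: "linear_form scale g" and h: "linear_form scale h"
  shows "f (br (sharp g) (sharp h)) - g (br (sharp h) (sharp f)) + g (br (sharp f) (sharp h))
    - h (br (sharp g) (sharp f)) = 0"
proof -
  let ?F = "\<lambda>ai bi aj bj. tens3 scale (br ai aj) bi bj + tens3 scale ai (br aj bi - br bi aj) bj
    - tens3 scale ai aj (br bj bi)"
  have bil: "bilinear_map scale (*) (\<lambda>aj bj. ?F ai bi aj bj U)"
    "bilinear_map scale (*) (\<lambda>ai bi. ?F ai bi aj bj U)" for ai bi aj bj U
    using trilinear_map_tens3_apply[OF vs, of U] br_bilinear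
    unfolding plus_fun_apply minus_apply
      trilinear_map_diff_middle[OF trilinear_map_tens3_apply[OF vs, of U]]
      trilinear_map_iff bilinear_map_iff
    by (simp_all add: algebra_simps)
  have inner_apply: "tensor_lift scale (?F ai bi) r U = r (\<lambda>aj bj. ?F ai bi aj bj U)" for ai bi U
    by (rule tensor_lift_apply[OF r_in bil(1)])
  have outer_apply: "tensor_lift scale (\<lambda>ai bi. tensor_lift scale (?F ai bi) r) r U
      = r (\<lambda>ai bi. r (\<lambda>aj bj. ?F ai bi aj bj U))" for U
    by (subst tensor_lift_apply[OF r_in])
      (simp_all only: inner_apply bilinear_map_tensor2_eval[OF r_in bil(2) bil(1)])
  have lin: "linear_form scale (\<lambda>x. p (br x y))" "linear_form scale (\<lambda>x. p (br y x))"
    if "linear_form scale p" for p y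
    using that br_bilinear unfolding bilinear_map_iff linear_form_iff by simp_all
  have r_mult: "r (\<lambda>u v. p u * q v) = p (sharp q)" "r (\<lambda>u v. p u * q v) = - q (sharp p)"
    if "linear_form scale p" "linear_form scale q" for p q
    using that by (simp_all add: linear_form_sharp pair_skew[of p q] flip: pair_def)
  have t3: "tens3 scale x y z (\<lambda>x y z. f x * g y * h z) = f x * g y * h z" for x y z
    by (simp only: tens3_def trilinear_form_mult[OF f g h] if_True)
  have inner: "r (\<lambda>aj bj. ?F ai bi aj bj (\<lambda>x y z. f x * g y * h z))
      = f (br ai (sharp h)) * g bi + (f ai * g (br (sharp h) bi) - f ai * g (br bi (sharp h)))
        + f ai * h (br (sharp g) bi)" for ai bi
  proof -
    \<comment> \<open>Factors constant in the inner sum are pulled to the left, so that each term is a scalar times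
      a product of linear forms in \<open>aj\<close> and \<open>bj\<close>.\<close>
    have "(\<lambda>aj bj. ?F ai bi aj bj (\<lambda>x y z. f x * g y * h z))
      = (\<lambda>aj bj. g bi * (f (br ai aj) * h bj)
          + (f ai * (g (br aj bi) * h bj) - f ai * (g (br bi aj) * h bj))
          - f ai * (g aj * h (br bj bi)))"
      by (intro ext) (simp only: plus_fun_apply minus_apply t3 linear_form_diff[OF g],
          simp add: algebra_simps)
    then show ?thesis
      by (simp add: f g h lin bilinear_form_intros tensor2_eval_simps[OF r_in] r_mult(1)[of _ h]
          r_mult(2)[of g])
  qed
  have "r (\<lambda>ai bi. f (br ai (sharp h)) * g bi
      + (f ai * g (br (sharp h) bi) - f ai * g (br bi (sharp h)))
      + f ai * h (br (sharp g) bi)) = 0"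
    using outer_apply[of "\<lambda>x y z. f x * g y * h z"] triangular
    unfolding triangular_left_alia_bialgebra_def left_alia_YBE_def inner by simp
  moreover have "r (\<lambda>ai bi. f (br ai (sharp h)) * g bi
      + (f ai * g (br (sharp h) bi) - f ai * g (br bi (sharp h)))
      + f ai * h (br (sharp g) bi))
    = f (br (sharp g) (sharp h)) + (- g (br (sharp h) (sharp f)) - - g (br (sharp f) (sharp h)))
      + - h (br (sharp g) (sharp f))"
    by (simp only: f g h lin bilinear_form_intros tensor2_eval_simps[OF r_in] r_mult(1)[of _ g]
        r_mult(2)[of f])
  ultimately show ?thesis by (simp add: algebra_simps)
qed

text \<open>
  Expanding the brackets in \<open>YBE_sharp\<close> leaves pairings in which \<open>T\<close> sits inside a product. Three
  instances of closedness of the pairing move it outside; the remaining terms cancel.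
\<close>

lemma T_closed:
  assumes f: "linear_form scale f" and g: "linear_form scale g" and h: "linear_form scale h"
  shows "pair (h \<star> g) (T f) - pair (g \<star> h) (T f) = pair (f \<star> h) (T g) - pair (f \<star> g) (T h)"
proof -
  have "pair (h \<star> T g) f - pair (T g \<star> h) f - pair (T f \<star> h) g
      - (pair (f \<star> T h) g - pair (T h \<star> f) g - pair (T g \<star> f) h)
      + (pair (f \<star> T g) h - pair (T g \<star> f) h - pair (T h \<star> f) g)
      - (pair (g \<star> T h) f - pair (T h \<star> g) f - pair (T f \<star> g) h) = 0"
    using YBE_sharp[OF h f g] by (simp only: linear_form_br_sharp f g h)
  then show ?thesis
    using pair_cosymplectic[OF h g linear_form_T[of f]]
      pair_cosymplectic[OF h linear_form_T[of g] f] pair_cosymplectic[OF g linear_form_T[of h] f]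
    by algebra
qed

text \<open>
  Paired with a third form \<open>h\<close>, the two sides differ by a combination of closedness of the pairing at
  \<open>(h, T g, f)\<close> and at \<open>(h, g, T f)\<close> and of \<open>T_closed\<close>. Skewness and \<open>pair_T\<close> first move \<open>h\<close> to the
  second place.
\<close>

lemma br_sharp:
  assumes f: "linear_form scale f" and g: "linear_form scale g"
  shows "br (sharp f) (sharp g) + sharp (T (f \<star> g)) = sharp (T f \<star> g) + sharp (f \<star> T g)"
proof (rule linear_form_eqI[OF vs])
  fix h assume h: "linear_form scale h"
  have "pair h (T (f \<star> g)) = - pair (f \<star> g) (T h)"
    using pair_T[OF h linear_form_conv] pair_skew[OF linear_form_T linear_form_conv] by metis
  moreover have "pair h (T f \<star> g) = - pair (T f \<star> g) h" "pair h (f \<star> T g) = - pair (f \<star> T g) h"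
    using pair_skew[OF h] by simp_all
  ultimately have "(pair (h \<star> T g) f - pair (T g \<star> h) f - pair (T f \<star> h) g) + pair h (T (f \<star> g))
      = pair h (T f \<star> g) + pair h (f \<star> T g)"
    using T_closed[OF f g h] pair_cosymplectic[OF h linear_form_T[of g] f]
      pair_cosymplectic[OF h g linear_form_T[of f]]
    by algebra
  then have "h (br (sharp f) (sharp g)) + h (sharp (T (f \<star> g)))
      = h (sharp (T f \<star> g)) + h (sharp (f \<star> T g))"
    by (simp only: linear_form_br_sharp linear_form_sharp linear_form_conv linear_form_T f g h)
  then show "h (br (sharp f) (sharp g) + sharp (T (f \<star> g))) = h (sharp (T f \<star> g) + sharp (f \<star> T g))"
    using h unfolding linear_form_iff by simp
qed

lemma T_nijenhuis:
  assumes f: "linear_form scale f" and g: "linear_form scale g"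
  shows "(T f \<star> T g) x + T (T (f \<star> g)) x = T (T f \<star> g) x + T (f \<star> T g) x"
proof -
  have "w (u + v) x = w u x + w v x" for u v
    using w_bilinear unfolding bilinear_form_iff by simp
  then show ?thesis
    using arg_cong[OF br_sharp[OF f g], of "\<lambda>u. w u x"] w_br by (simp add: T_def)
qed

abbreviation S :: "'a \<Rightarrow> 'a" where
  "S \<equiv> contract scale r w"

lemma S_eq: "S x = - sharp (w x)"
proof -
  have bil: "bilinear_map scale scale (\<lambda>a b. scale (w b x) a)"
    using w_bilinear unfolding bilinear_map_iff
    by (simp add: vs scale_right_distrib scale_left_distrib mult.commute)
  show ?thesis
  proof (rule linear_form_eqI[OF vs])
    fix f assume f: "linear_form scale f"
    have "f (S x) = r (\<lambda>a b. f (scale (w b x) a))"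
      unfolding contract_def by (rule tensor2_eval_lift[OF r_in bil f])
    also have "(\<lambda>a b. f (scale (w b x) a)) = (\<lambda>a b. - (f a * w x b))"
    proof (intro ext)
      fix a b
      have "f (scale (w b x) a) = w b x * f a"
        using f unfolding linear_form_iff by blast
      then show "f (scale (w b x) a) = - (f a * w x b)"
        by (simp add: w_skew[of b x])
    qed
    also have "r \<dots> = - pair f (w x)"
      unfolding pair_def by (rule tensor2_eval_minus[OF r_in bilinear_form_mult[OF f linear_form_w]])
    also have "\<dots> = f (- sharp (w x))"
      by (simp add: linear_form_neg[OF f] linear_form_sharp[OF f linear_form_w])
    finally show "f (S x) = f (- sharp (w x))" .
  qed
qed

lemma linear_form_S:
  assumes f: "linear_form scale f"
  shows "f (S x) = - T f x"
proof -
  have "f (S x) = - pair f (w x)"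
    by (simp add: S_eq linear_form_neg[OF f] linear_form_sharp[OF f linear_form_w])
  also have "\<dots> = w x (sharp f)"
    using pair_skew[OF f linear_form_w] linear_form_sharp[OF linear_form_w f] by simp
  also have "\<dots> = - T f x"
    unfolding T_def by (rule w_skew)
  finally show ?thesis .
qed

lemma linear_S: "Vector_Spaces.linear scale scale S"
  unfolding Vector_Spaces.linear_iff
proof (intro conjI allI vs)
  show "S (x + y) = S x + S y" for x y
  proof (rule linear_form_eqI[OF vs])
    fix f assume f: "linear_form scale f"
    then have "f (S x + S y) = f (S x) + f (S y)" unfolding linear_form_iff by simp
    moreover have "T f (x + y) = T f x + T f y"
      using linear_form_T unfolding linear_form_iff by blast
    ultimately show "f (S (x + y)) = f (S x + S y)"
      by (simp add: linear_form_S f)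
  qed
  show "S (scale c x) = scale c (S x)" for c x
  proof (rule linear_form_eqI[OF vs])
    fix f assume f: "linear_form scale f"
    then have "f (scale c (S x)) = c * f (S x)" unfolding linear_form_iff by simp
    moreover have "T f (scale c x) = c * T f x"
      using linear_form_T unfolding linear_form_iff by blast
    ultimately show "f (S (scale c x)) = f (scale c (S x))"
      by (simp add: linear_form_S f)
  qed
qed

text \<open>
  At \<open>f \<otimes> g\<close> both sides become the two sides of \<open>T_nijenhuis\<close>, because \<open>S\<close> occurs twice in each term
  and so the signs of the transposes cancel.
\<close>

lemma nijenhuis_S:
  "tensor_map scale S S (\<Delta> x) + \<Delta> (S (S x))
    = tensor_map scale S id (\<Delta> (S x)) + tensor_map scale id S (\<Delta> (S x))"
proof (rule tensor2_eqI[OF vs])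
  have id: "Vector_Spaces.linear scale scale id"
    by (simp add: Vector_Spaces.linear_iff vs)
  show "tensor_map scale S S (\<Delta> x) + \<Delta> (S (S x)) \<in> tensor2_space scale"
    "tensor_map scale S id (\<Delta> (S x)) + tensor_map scale id S (\<Delta> (S x)) \<in> tensor2_space scale"
    by (intro tensor2_space_add[OF vs] tensor_map_in_space linear_S id comult_in)+
  fix f g assume f: "linear_form scale f" and g: "linear_form scale g"
  have map_apply: "tensor_map scale p q (\<Delta> z) (\<lambda>u v. f u * g v)
      = ((\<lambda>u. f (p u)) \<star> (\<lambda>v. g (q v))) z"
    if "Vector_Spaces.linear scale scale p" "Vector_Spaces.linear scale scale q" for p q z
    unfolding conv_def
    by (rule tensor_map_apply[OF that comult_in bilinear_form_mult[OF f g]])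
  have minus: "((\<lambda>u. - T f u) \<star> (\<lambda>v. - T g v)) x = (T f \<star> T g) x"
    unfolding conv_def by simp
  have "\<Delta> (S (S x)) (\<lambda>u v. f u * g v) = T (T (f \<star> g)) x"
    using linear_form_S[OF linear_form_conv[of f g]] linear_form_S[OF linear_form_T[of "f \<star> g"]]
    by (simp add: conv_def)
  then show "(tensor_map scale S S (\<Delta> x) + \<Delta> (S (S x))) (\<lambda>u v. f u * g v)
      = (tensor_map scale S id (\<Delta> (S x)) + tensor_map scale id S (\<Delta> (S x))) (\<lambda>u v. f u * g v)"
    using T_nijenhuis[OF f g, of x]
    by (simp add: map_apply linear_S id linear_form_S f g conv_minus minus)
qed

end

theorem theorem5p12:
  fixes scale :: "'k::field_char_0 \<Rightarrow> 'a::ab_group_add \<Rightarrow> 'a"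
    and \<Delta> :: "'a \<Rightarrow> ('a, 'k) tensor2"
    and r :: "('a, 'k) tensor2"
    and \<omega> :: "('a, 'k) tensor2 \<Rightarrow> 'k"
  assumes "cosymplectic_left_alia_coalgebra scale \<Delta> r"
    and "\<omega> \<in> tensor2_dual scale"
    and "dual_triangular_left_alia_bialgebra scale \<Delta> (form_of scale \<omega>)"
    and "triangular_left_alia_bialgebra scale (bracket_of scale \<Delta> (form_of scale \<omega>)) r"
  shows "nijenhuis_left_alia_coalgebra scale \<Delta> (contract scale r (form_of scale \<omega>))"
proof -
  interpret cosymplectic_left_alia_coalgebra scale \<Delta> r by fact
  interpret cosymplectic_dual_triangular scale \<Delta> r "form_of scale \<omega>"
    by unfold_locales fact+
  show ?thesis
    by (intro nijenhuis_left_alia_coalgebra.intro nijenhuis_left_alia_coalgebra_axioms.intro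
        left_alia_coalgebra_axioms linear_S nijenhuis_S)
qed

end
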